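(* Let $\alpha\in(\tfrac12,1)$, $\sigma>0$, $\lambda\in\{1,-1\}$, let $N$ be a positive even integer, and consider the midpoint scheme, for $0\le j\le N-1$ and time steps $n=0,1,\dots$, $$\frac{p^{n+1}_j-p^n_j}{\Delta t}+\big(D_2^\alpha\mathbf{q}^{n+\frac12}\big)_j-\lambda\Big[(p_j^{n+\frac12})^2+(q_j^{n+\frac12})^2\Big]^\sigma q_j^{n+\frac12}-q_j^{n+\frac12}\,\Delta\dot W_n(x_j)=0,$$ $$\frac{q^{n+1}_j-q^n_j}{\Delta t}-\big(D_2^\alpha\mathbf{p}^{n+\frac12}\big)_j+\lambda\Big[(p_j^{n+\frac12})^2+(q_j^{n+\frac12})^2\Big]^\sigma p_j^{n+\frac12}+p_j^{n+\frac12}\,\Delta\dot W_n(x_j)=0,$$ where $\mathbf{p}^{n+\frac12}=\frac12(\mathbf{p}^n+\mathbf{p}^{n+1})$, $\mathbf{q}^{n+\frac12}=\frac12(\mathbf{q}^n+\mathbf{q}^{n+1})$. Then the scheme preserves the stochastic symplectic structure, i.e. $$\sum_{j=0}^{N-1}dp_j^{n+1}\wedge dq_j^{n+1}=\sum_{j=0}^{N-1}dp_j^{n}\wedge dq_j^{n}.$$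
   Context: The scheme discretizes $i\,du-[(-\Delta)^\alpha u+\lambda|u|^{2\sigma}u]dt=u\circ dW(t)$, $u=p+iq$, on the interval $(a,b)$ (periodic Fourier pseudospectral discretization). Grid: $h=(b-a)/N$, $x_j=a+jh$, $\mu=2\pi/(b-a)$; $\mathbf{p}^n=(p^n_0,\dots,p^n_{N-1})^T$, $\mathbf{q}^n=(q^n_0,\dots,q^n_{N-1})^T\in\mathbb{R}^N$ approximate $p,q$ at $(x_j,t_n)$, with $t_n=n\Delta t$. $D_2^\alpha$ is the $N\times N$ real symmetric matrix approximating $-(-\Delta)^\alpha$: $$(D_2^\alpha)_{j,l}=-\sum_{k=-N/2}^{N/2}\frac{1}{Nc_k}|k\mu|^{2\alpha}e^{ik\mu(x_j-x_l)},\qquad c_k=1\ (|k|<N/2),\ c_{\pm N/2}=2.$$ $W(t,x)$ is a real-valued Wiener process and $\Delta\dot W_n(x_j)=\big(W(t_{n+1},x_j)-W(t_n,x_j)\big)/\Delta t$. $d$ is the exterior differential with respect to the initial data $(\mathbf{p}^0,\mathbf{q}^0)\in\mathbb{R}^{2N}$ for a fixed realization of $W$; the numerical solution $(\mathbf{p}^n,\mathbf{q}^n)$ is understood to depend differentiably on the data. *)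

theory Defs
  imports "HOL-Probability.Probability"
begin

subsection \<open>Wiener process\<close>

text \<open>The degenerate law (point mass at 0) counts as a Gaussian of variance 0.\<close>

definition centered_gaussian :: "'w measure \<Rightarrow> real \<Rightarrow> ('w \<Rightarrow> real) \<Rightarrow> bool" where
  "centered_gaussian M v X \<longleftrightarrow>
     X \<in> borel_measurable M \<and>
     (v = 0 \<and> (AE \<omega> in M. X \<omega> = 0) \<or>
      v > 0 \<and> distributed M lborel X (\<lambda>x. ennreal (normal_density 0 (sqrt v) x)))"

text \<open>
  A real-valued Wiener process \<open>W(t,x)\<close> with \<open>t \<ge> 0\<close> and \<open>x\<close> in the spatial domain \<open>I\<close>:
  a process that starts at 0, has continuous trajectories and independent increments
  (independent as random fields over \<open>I\<close>), and whose increments are jointly centred Gaussian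
  in space with \<open>Cov (W(t,x) - W(s,x), W(t,y) - W(s,y)) = (t - s) Q(x,y)\<close>. The spatial
  covariance \<open>Q\<close> is arbitrary. Joint Gaussianity is expressed by requiring all finite linear
  combinations to be Gaussian.
\<close>

definition wiener_process ::
    "'w measure \<Rightarrow> real set \<Rightarrow> (real \<Rightarrow> real \<Rightarrow> 'w \<Rightarrow> real) \<Rightarrow> bool" where
  "wiener_process M I W \<longleftrightarrow>
     prob_space M \<and>
     (\<forall>t\<ge>0. \<forall>x\<in>I. W t x \<in> borel_measurable M) \<and>
     (\<forall>x\<in>I. AE \<omega> in M. W 0 x \<omega> = 0) \<and>
     (\<forall>x\<in>I. AE \<omega> in M. continuous_on {0..} (\<lambda>t. W t x \<omega>)) \<and>
     (\<forall>\<tau> :: nat \<Rightarrow> real. \<forall>m. mono \<tau> \<and> 0 \<le> \<tau> 0 \<longrightarrow>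
        prob_space.indep_vars M (\<lambda>_. PiM I (\<lambda>_. borel))
          (\<lambda>i \<omega>. \<lambda>x\<in>I. W (\<tau> (Suc i)) x \<omega> - W (\<tau> i) x \<omega>) {..<m}) \<and>
     (\<exists>Q :: real \<Rightarrow> real \<Rightarrow> real.
        \<forall>s t. 0 \<le> s \<and> s \<le> t \<longrightarrow>
          (\<forall>F c. finite F \<and> F \<subseteq> I \<longrightarrow>
             centered_gaussian M ((t - s) * (\<Sum>x\<in>F. \<Sum>y\<in>F. c x * c y * Q x y))
               (\<lambda>\<omega>. \<Sum>x\<in>F. c x * (W t x \<omega> - W s x \<omega>))))"

definition noise_increment ::
    "(real \<Rightarrow> real \<Rightarrow> 'w \<Rightarrow> real) \<Rightarrow> real \<Rightarrow> nat \<Rightarrow> real \<Rightarrow> 'w \<Rightarrow> real" where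
  "noise_increment W dt n x \<omega> =
     (W (real (Suc n) * dt) x \<omega> - W (real n * dt) x \<omega>) / dt"

subsection \<open>Fourier pseudospectral discretization\<close>

definition grid_point :: "real \<Rightarrow> real \<Rightarrow> nat \<Rightarrow> nat \<Rightarrow> real" where
  "grid_point a b N j = a + real j * ((b - a) / real N)"

definition fourier_c :: "nat \<Rightarrow> int \<Rightarrow> real" where
  "fourier_c N k = (if \<bar>k\<bar> = int (N div 2) then 2 else 1)"

definition D2_entry :: "real \<Rightarrow> real \<Rightarrow> real \<Rightarrow> nat \<Rightarrow> nat \<Rightarrow> nat \<Rightarrow> complex" where
  "D2_entry \<alpha> a b N j l =
     (let \<mu> = 2 * pi / (b - a) in
      - (\<Sum>k\<in>{- int (N div 2)..int (N div 2)}.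
          complex_of_real (1 / (real N * fourier_c N k) * \<bar>of_int k * \<mu>\<bar> powr (2 * \<alpha>)) *
          exp (\<i> * complex_of_real (of_int k * \<mu> * (grid_point a b N j - grid_point a b N l)))))"

text \<open>The entries are real, so that no information is lost by taking the real part below.\<close>

lemma D2_entry_real: "complex_of_real (Re (D2_entry \<alpha> a b N j l)) = D2_entry \<alpha> a b N j l"
proof -
  have "cnj (D2_entry \<alpha> a b N j l) = D2_entry \<alpha> a b N j l"
    unfolding D2_entry_def Let_def complex_cnj_minus cnj_sum
    by (subst sum.reindex_bij_witness[where i = uminus and j = uminus])
       (auto simp: fourier_c_def exp_cnj simp flip: of_real_minus)
  then show ?thesis
    by (metis Reals_cnj_iff of_real_Re)
qed

lemma D2_entry_sym: "D2_entry \<alpha> a b N l j = D2_entry \<alpha> a b N j l"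
  unfolding D2_entry_def Let_def
  by (subst sum.reindex_bij_witness[where i = uminus and j = uminus])
     (auto simp: fourier_c_def algebra_simps)

text \<open>
  Vectors in \<open>\<real>\<^sup>N\<close> are rendered as \<open>real ^ 'n\<close>; the map \<open>ix\<close>, meant to be a bijection from the index
  type onto \<open>{0..<N}\<close>, tells which grid point a component belongs to.
\<close>

definition D2 :: "real \<Rightarrow> real \<Rightarrow> real \<Rightarrow> nat \<Rightarrow> ('n::finite \<Rightarrow> nat) \<Rightarrow> real ^ 'n ^ 'n" where
  "D2 \<alpha> a b N ix = (\<chi> j l. Re (D2_entry \<alpha> a b N (ix j) (ix l)))"

definition half_step :: "(nat \<Rightarrow> 'e \<Rightarrow> real ^ 'n::finite) \<Rightarrow> nat \<Rightarrow> 'e \<Rightarrow> real ^ 'n" where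
  "half_step u n z = (1/2) *\<^sub>R (u n z + u (Suc n) z)"

subsection \<open>Exterior differential of functions and wedge product of 1-forms\<close>

definition ext_d :: "('e::real_normed_vector \<Rightarrow> real) \<Rightarrow> 'e \<Rightarrow> 'e \<Rightarrow> real" where
  "ext_d f z v = frechet_derivative f (at z) v"

definition wedge ::
    "('e \<Rightarrow> 'e \<Rightarrow> real) \<Rightarrow> ('e \<Rightarrow> 'e \<Rightarrow> real) \<Rightarrow> 'e \<Rightarrow> 'e \<Rightarrow> 'e \<Rightarrow> real" (infixr "\<and>\<^sub>d" 72) where
  "(\<theta> \<and>\<^sub>d \<eta>) z v w = \<theta> z v * \<eta> z w - \<theta> z w * \<eta> z v"

end

theory Submission
  imports Defs
begin

text \<open>
  The scheme is the implicit midpoint rule \<open>z\<^sub>1 - z\<^sub>0 = J F((z\<^sub>0 + z\<^sub>1)/2)\<close> in the phase space of the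
  pairs \<open>z = (p, q)\<close>, where \<open>J (x, y) = (-y, x)\<close> and, for a fixed realization of the noise, \<open>F\<close> is
  the gradient of a (time-dependent) Hamiltonian. Differentiating a step in the initial data gives
  \<open>\<delta>\<^sub>1 - \<delta>\<^sub>0 = J S ((\<delta>\<^sub>0 + \<delta>\<^sub>1)/2)\<close> for every tangent vector, with the same Hessian \<open>S\<close> of
  that Hamiltonian at the midpoint. As the wedge product is bilinear, its change over a step pairs
  only the increments with the midpoints:
  \<open>\<Omega>(\<delta>\<^sub>1, \<epsilon>\<^sub>1) - \<Omega>(\<delta>\<^sub>0, \<epsilon>\<^sub>0) = \<Omega>(J S \<delta>, \<epsilon>) + \<Omega>(\<delta>, J S \<epsilon>) = -\<langle>S \<delta>, \<epsilon>\<rangle> + \<langle>\<delta>, S \<epsilon>\<rangle>\<close>,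
  where \<open>\<delta>\<close>, \<open>\<epsilon>\<close> are the midpoints of the two tangent vectors. This vanishes because \<open>S\<close> is
  symmetric; it is the content of \<open>midpoint_step_symplectic\<close>.

  It remains to see that \<open>F\<close> is differentiable with symmetric derivative. The noise and the
  dispersion contribute symmetric linear maps, the latter because \<open>D2\<close> is symmetric. The nonlinearity acts
  at each grid point as the radial map \<open>u \<mapsto> |u|\<^sup>2\<^sup>\<sigma> u\<close> of the plane. For a small exponent
  the factor \<open>|u|\<^sup>2\<^sup>\<sigma>\<close> has no derivative at the origin, but the map itself does, since it is of order
  \<open>|u|\<^sup>2\<^sup>\<sigma>\<^sup>+\<^sup>1\<close>; this is \<open>has_derivative_radial_power\<close>.
\<close>

section \<open>Midpoint steps along Hamiltonian vector fields\<close>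

definition symplectic_form :: "'a::real_inner \<times> 'a \<Rightarrow> 'a \<times> 'a \<Rightarrow> real" where
  "symplectic_form x y = fst x \<bullet> snd y - fst y \<bullet> snd x"

definition symplectic_J :: "'a::real_inner \<times> 'a \<Rightarrow> 'a \<times> 'a" where
  "symplectic_J x = (- snd x, fst x)"

lemma bounded_linear_symplectic_J: "bounded_linear symplectic_J"
  unfolding symplectic_J_def
  by (intro bounded_linear_Pair bounded_linear_minus bounded_linear_snd bounded_linear_fst)

lemma symplectic_form_diff_midpoint:
  "symplectic_form x1 y1 - symplectic_form x0 y0 =
     symplectic_form (x1 - x0) ((1/2) *\<^sub>R (y0 + y1)) + symplectic_form ((1/2) *\<^sub>R (x0 + x1)) (y1 - y0)"
  by (simp add: symplectic_form_def inner_simps field_simps)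

lemma symplectic_form_J:
  "symplectic_form (symplectic_J x) y = - (x \<bullet> y)"
  "symplectic_form x (symplectic_J y) = x \<bullet> y"
  by (simp_all add: symplectic_form_def symplectic_J_def inner_prod_def inner_commute)

text \<open>
  This is the Cayley transform argument: \<open>J S\<close> is infinitesimally symplectic for symmetric \<open>S\<close>, so the
  linearized midpoint step is symplectic. Differentiating the implicit equation along its given
  differentiable solution replaces any appeal to the implicit function theorem.
\<close>

theorem midpoint_step_symplectic:
  fixes F :: "'a::real_inner \<times> 'a \<Rightarrow> 'a \<times> 'a" and z0 z1 :: "'e::real_normed_vector \<Rightarrow> 'a \<times> 'a"
  assumes z0: "(z0 has_derivative z0') (at x)" and z1: "(z1 has_derivative z1') (at x)"
    and F: "(F has_derivative S) (at ((1/2) *\<^sub>R (z0 x + z1 x)))"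
    and sym: "\<And>h k. S h \<bullet> k = h \<bullet> S k"
    and U: "open U" "x \<in> U"
    and step: "\<And>y. y \<in> U \<Longrightarrow> z1 y - z0 y = symplectic_J (F ((1/2) *\<^sub>R (z0 y + z1 y)))"
  shows "symplectic_form (z1' v) (z1' w) = symplectic_form (z0' v) (z0' w)"
proof -
  have mid: "((\<lambda>y. (1/2) *\<^sub>R (z0 y + z1 y)) has_derivative (\<lambda>h. (1/2) *\<^sub>R (z0' h + z1' h))) (at x)"
    by (intro derivative_intros z0 z1)
  have "((\<lambda>y. symplectic_J (F ((1/2) *\<^sub>R (z0 y + z1 y)))) has_derivative
      (\<lambda>h. symplectic_J (S ((1/2) *\<^sub>R (z0' h + z1' h))))) (at x)"
    by (intro bounded_linear.has_derivative[OF bounded_linear_symplectic_J]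
        has_derivative_compose[OF mid F])
  then have "((\<lambda>y. z1 y - z0 y) has_derivative
      (\<lambda>h. symplectic_J (S ((1/2) *\<^sub>R (z0' h + z1' h))))) (at x)"
    by (rule has_derivative_transform_within_open[OF _ U]) (simp add: step)
  from has_derivative_unique[OF this has_derivative_diff[OF z1 z0]]
  have step': "z1' h - z0' h = symplectic_J (S ((1/2) *\<^sub>R (z0' h + z1' h)))" for h
    by metis
  show ?thesis
    using symplectic_form_diff_midpoint[of "z1' v" "z1' w" "z0' v" "z0' w"]
    by (simp only: step' symplectic_form_J sym)
qed

section \<open>The power nonlinearity\<close>

text \<open>
  Away from the origin this is the chain rule. At the origin the claimed derivative is zero and the
  difference quotient has norm \<open>(h \<bullet> h) powr \<sigma>\<close>, which tends to zero as \<open>\<sigma> > 0\<close>; the formula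
  covers this case, its second summand being killed by the factor \<open>u\<close>.
\<close>

lemma has_derivative_radial_power:
  fixes u :: "'a::real_inner"
  assumes "\<sigma> > 0"
  shows "((\<lambda>u. (u \<bullet> u) powr \<sigma> *\<^sub>R u) has_derivative
     (\<lambda>h. (u \<bullet> u) powr \<sigma> *\<^sub>R h + (2 * \<sigma> * (u \<bullet> u) powr (\<sigma> - 1) * (u \<bullet> h)) *\<^sub>R u)) (at u)"
proof (cases "u = 0")
  case True
  have "((\<lambda>h::'a. h \<bullet> h) \<longlongrightarrow> (0::'a) \<bullet> 0) (at 0)"
    by (rule tendsto_inner[OF tendsto_ident_at tendsto_ident_at])
  then have "((\<lambda>h::'a. (h \<bullet> h) powr \<sigma>) \<longlongrightarrow> 0) (at 0)"
    using assms by (intro tendsto_zero_powrI[where b = \<sigma>]) auto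
  then have "((\<lambda>h::'a. norm ((h \<bullet> h) powr \<sigma> *\<^sub>R h) / norm h) \<longlongrightarrow> 0) (at 0)"
    by (rule Lim_transform_eventually) (auto simp: eventually_at_filter)
  then show ?thesis
    using True by (simp add: has_derivative_at)
next
  case False
  have inner: "((\<lambda>u. u \<bullet> u) has_derivative (\<lambda>h. u \<bullet> h + h \<bullet> u)) (at u)"
    by (intro derivative_intros)
  have "((\<lambda>u. (u \<bullet> u) powr \<sigma>) has_derivative
      (\<lambda>h. (u \<bullet> u) powr \<sigma> * (0 * ln (u \<bullet> u) + (u \<bullet> h + h \<bullet> u) * \<sigma> / (u \<bullet> u)))) (at u)"
    by (intro has_derivative_powr inner has_derivative_const) (use False in auto)
  then have "((\<lambda>u. (u \<bullet> u) powr \<sigma>) has_derivative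
      (\<lambda>h. 2 * \<sigma> * (u \<bullet> u) powr (\<sigma> - 1) * (u \<bullet> h))) (at u)"
    using False by (simp add: powr_diff inner_commute field_simps)
  from has_derivative_scaleR[OF this has_derivative_ident] show ?thesis
    by simp
qed

lemma has_derivative_vec_lambda:
  fixes f :: "'i::finite \<Rightarrow> 'e::real_normed_vector \<Rightarrow> 'a::euclidean_space"
  assumes "\<And>i. (f i has_derivative f' i) (at x within T)"
  shows "((\<lambda>y. \<chi> i. f i y) has_derivative (\<lambda>h. \<chi> i. f' i h)) (at x within T)"
  by (subst has_derivative_componentwise_within)
    (auto simp: Basis_vec_def inner_axis intro!: has_derivative_inner_left assms)

section \<open>The scheme as a Hamiltonian midpoint rule\<close>

lemma D2_symmetric: "transpose (D2 \<alpha> a b N ix) = D2 \<alpha> a b N ix"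
  by (simp add: transpose_def D2_def vec_eq_iff D2_entry_sym)

text \<open>
  The point \<open>(p\<^sub>j, q\<^sub>j)\<close> of the plane at node \<open>j\<close>. In terms of it the nodal part of the force is a scalar
  multiple of the identity plus a radial map, which makes its symmetry visible.
\<close>

definition node :: "'n::finite \<Rightarrow> (real ^ 'n) \<times> (real ^ 'n) \<Rightarrow> real \<times> real" where
  "node j z = (fst z $ j, snd z $ j)"

lemma bounded_linear_node: "bounded_linear (node j)"
  unfolding node_def
  by (intro bounded_linear_Pair bounded_linear_compose[OF bounded_linear_vec_nth]
      bounded_linear_fst bounded_linear_snd)

definition unnode :: "('n::finite \<Rightarrow> real \<times> real) \<Rightarrow> (real ^ 'n) \<times> (real ^ 'n)" where
  "unnode f = (\<chi> j. fst (f j), \<chi> j. snd (f j))"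

lemma inner_unnode:
  "unnode f \<bullet> z = (\<Sum>j\<in>UNIV. f j \<bullet> node j z)" "z \<bullet> unnode f = (\<Sum>j\<in>UNIV. node j z \<bullet> f j)"
  by (simp_all add: unnode_def node_def inner_prod_def inner_vec_def sum.distrib)

lemma has_derivative_unnode:
  assumes "\<And>j. (f j has_derivative f' j) (at x within T)"
  shows "((\<lambda>y. unnode (\<lambda>j. f j y)) has_derivative (\<lambda>h. unnode (\<lambda>j. f' j h))) (at x within T)"
  unfolding unnode_def
  by (intro has_derivative_Pair has_derivative_vec_lambda has_derivative_fst has_derivative_snd assms)

definition nodal_force :: "real \<Rightarrow> real \<Rightarrow> real \<Rightarrow> real \<times> real \<Rightarrow> real \<times> real" where
  "nodal_force \<sigma> lam c u = lam *\<^sub>R ((u \<bullet> u) powr \<sigma> *\<^sub>R u) + c *\<^sub>R u"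

definition nodal_hessian :: "real \<Rightarrow> real \<Rightarrow> real \<Rightarrow> real \<times> real \<Rightarrow> real \<times> real \<Rightarrow> real \<times> real" where
  "nodal_hessian \<sigma> lam c u h =
     lam *\<^sub>R ((u \<bullet> u) powr \<sigma> *\<^sub>R h + (2 * \<sigma> * (u \<bullet> u) powr (\<sigma> - 1) * (u \<bullet> h)) *\<^sub>R u) + c *\<^sub>R h"

lemma has_derivative_nodal_force:
  "\<sigma> > 0 \<Longrightarrow> (nodal_force \<sigma> lam c has_derivative nodal_hessian \<sigma> lam c u) (at u)"
  unfolding nodal_force_def nodal_hessian_def
  by (intro has_derivative_add has_derivative_scaleR_right has_derivative_radial_power
      has_derivative_ident)

lemma nodal_hessian_symmetric: "nodal_hessian \<sigma> lam c u h \<bullet> k = h \<bullet> nodal_hessian \<sigma> lam c u k"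
  by (simp add: nodal_hessian_def inner_add_left inner_add_right inner_commute)

text \<open>
  For symmetric \<open>D\<close> this is the gradient of
  \<open>dt (\<langle>p, D p\<rangle> + \<langle>q, D q\<rangle>)/2 - dt \<Sum>\<^sub>j (lam |u\<^sub>j|\<^sup>2\<^sup>\<sigma>\<^sup>+\<^sup>2/(2\<sigma>+2) + c\<^sub>j |u\<^sub>j|\<^sup>2/2)\<close>
  with \<open>u\<^sub>j = (p\<^sub>j, q\<^sub>j)\<close>, where \<open>c\<^sub>j\<close> stands for the noise increment at node \<open>j\<close>.
\<close>

definition scheme_force ::
    "real \<Rightarrow> real ^ 'n ^ 'n \<Rightarrow> real \<Rightarrow> real \<Rightarrow> ('n::finite \<Rightarrow> real) \<Rightarrow>
      (real ^ 'n) \<times> (real ^ 'n) \<Rightarrow> (real ^ 'n) \<times> (real ^ 'n)" where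
  "scheme_force dt D \<sigma> lam c z =
     dt *\<^sub>R ((D *v fst z, D *v snd z) - unnode (\<lambda>j. nodal_force \<sigma> lam (c j) (node j z)))"

definition scheme_hessian ::
    "real \<Rightarrow> real ^ 'n ^ 'n \<Rightarrow> real \<Rightarrow> real \<Rightarrow> ('n::finite \<Rightarrow> real) \<Rightarrow>
      (real ^ 'n) \<times> (real ^ 'n) \<Rightarrow> (real ^ 'n) \<times> (real ^ 'n) \<Rightarrow> (real ^ 'n) \<times> (real ^ 'n)" where
  "scheme_hessian dt D \<sigma> lam c z h =
     dt *\<^sub>R ((D *v fst h, D *v snd h)
       - unnode (\<lambda>j. nodal_hessian \<sigma> lam (c j) (node j z) (node j h)))"

lemma has_derivative_scheme_force:
  assumes "\<sigma> > 0"
  shows "(scheme_force dt D \<sigma> lam c has_derivative scheme_hessian dt D \<sigma> lam c z) (at z)"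
proof -
  have "((\<lambda>z. nodal_force \<sigma> lam (c j) (node j z)) has_derivative
      (\<lambda>h. nodal_hessian \<sigma> lam (c j) (node j z) (node j h))) (at z)" for j
    by (rule has_derivative_compose[OF bounded_linear_imp_has_derivative[OF bounded_linear_node]
          has_derivative_nodal_force[OF assms]])
  then show ?thesis
    unfolding scheme_force_def scheme_hessian_def
    by (intro has_derivative_scaleR_right has_derivative_diff has_derivative_Pair
        has_derivative_unnode bounded_linear.has_derivative[OF matrix_vector_mul_bounded_linear]
        has_derivative_fst has_derivative_snd has_derivative_ident)
qed

lemma scheme_hessian_symmetric:
  assumes "transpose D = D"
  shows "scheme_hessian dt D \<sigma> lam c z h \<bullet> k = h \<bullet> scheme_hessian dt D \<sigma> lam c z k"
proof -
  have "(D *v x) \<bullet> y = x \<bullet> (D *v y)" for x y :: "real ^ 'a"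
    using assms by (metis dot_lmul_matrix transpose_matrix_vector)
  then show ?thesis
    by (simp add: scheme_hessian_def inner_diff_left inner_diff_right inner_unnode
        nodal_hessian_symmetric inner_prod_def[of "(_, _)"] inner_prod_def[of _ "(_, _)"])
qed

text \<open>
  The hypotheses of the scheme, solved for the increments, are this equation read off at each node:
  \<open>J\<close> exchanges the two equations and supplies the sign by which they differ.
\<close>

lemma midpoint_scheme_eq:
  fixes p0 p1 q0 q1 :: "real ^ 'n::finite"
  defines "x \<equiv> (1/2) *\<^sub>R (p0 + p1)" and "y \<equiv> (1/2) *\<^sub>R (q0 + q1)"
  assumes "dt \<noteq> 0"
    and p: "\<And>j. (p1 $ j - p0 $ j) / dt + (D *v y) $ j
          - lam * ((x $ j)\<^sup>2 + (y $ j)\<^sup>2) powr \<sigma> * y $ j - y $ j * c j = 0"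
    and q: "\<And>j. (q1 $ j - q0 $ j) / dt - (D *v x) $ j
          + lam * ((x $ j)\<^sup>2 + (y $ j)\<^sup>2) powr \<sigma> * x $ j + x $ j * c j = 0"
  shows "(p1, q1) - (p0, q0) =
    symplectic_J (scheme_force dt D \<sigma> lam c ((1/2) *\<^sub>R ((p0, q0) + (p1, q1))))"
proof -
  let ?r = "\<lambda>j. ((x $ j)\<^sup>2 + (y $ j)\<^sup>2) powr \<sigma>"
  have mid: "(1/2) *\<^sub>R ((p0, q0) + (p1, q1)) = (x, y)"
    by (simp add: x_def y_def)
  have "p1 $ j - p0 $ j = - (dt * ((D *v y) $ j - (lam * (?r j * y $ j) + c j * y $ j)))" for j
  proof -
    have "(p1 $ j - p0 $ j) / dt = - ((D *v y) $ j - (lam * (?r j * y $ j) + c j * y $ j))"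
      using p[of j] by (simp add: algebra_simps)
    then show ?thesis
      unfolding nonzero_divide_eq_eq[OF \<open>dt \<noteq> 0\<close>] by (metis mult.commute mult_minus_right)
  qed
  moreover have "q1 $ j - q0 $ j = dt * ((D *v x) $ j - (lam * (?r j * x $ j) + c j * x $ j))" for j
  proof -
    have "(q1 $ j - q0 $ j) / dt = (D *v x) $ j - (lam * (?r j * x $ j) + c j * x $ j)"
      using q[of j] by (simp add: algebra_simps)
    then show ?thesis
      unfolding nonzero_divide_eq_eq[OF \<open>dt \<noteq> 0\<close>] by (metis mult.commute mult_minus_right)
  qed
  ultimately show ?thesis
    unfolding mid
    by (simp add: vec_eq_iff symplectic_J_def scheme_force_def unnode_def node_def nodal_force_def
        power2_eq_square)
qed

lemma ext_d_component:
  assumes "(f has_derivative f') (at z)"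
  shows "ext_d (\<lambda>y. f y $ j) z v = f' v $ j"
proof -
  have "((\<lambda>y. f y $ j) has_derivative (\<lambda>h. f' h $ j)) (at z)"
    by (rule bounded_linear.has_derivative[OF bounded_linear_vec_nth assms])
  from frechet_derivative_at[OF this] show ?thesis
    by (metis ext_d_def)
qed

lemma sum_wedge_eq_symplectic_form:
  assumes "(f has_derivative f') (at z)" "(g has_derivative g') (at z)"
  shows "(\<Sum>j\<in>UNIV. (ext_d (\<lambda>y. f y $ j) \<and>\<^sub>d ext_d (\<lambda>y. g y $ j)) z v w) =
    symplectic_form (f' v, g' v) (f' w, g' w)"
  by (simp add: wedge_def ext_d_component[OF assms(1)] ext_d_component[OF assms(2)]
      symplectic_form_def inner_vec_def sum_subtractf)

theorem lemma11:
  fixes \<alpha> \<sigma> lam a b dt :: real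
    and N :: nat
    and ix :: "'n::finite \<Rightarrow> nat"
    and M :: "'w measure"
    and W :: "real \<Rightarrow> real \<Rightarrow> 'w \<Rightarrow> real"
    and \<omega> :: 'w
    and U :: "((real ^ 'n) \<times> (real ^ 'n)) set"
    and p q :: "nat \<Rightarrow> (real ^ 'n) \<times> (real ^ 'n) \<Rightarrow> real ^ 'n"
  assumes "1/2 < \<alpha>" "\<alpha> < 1" "\<sigma> > 0" "lam \<in> {1, -1}"
    and "a < b" "dt > 0"
    and "N > 0" "even N"
    and "bij_betw ix UNIV {0..<N}"
    and "wiener_process M {a..b} W" "\<omega> \<in> space M"
    and "open U"
    and init: "\<And>z. z \<in> U \<Longrightarrow> p 0 z = fst z" "\<And>z. z \<in> U \<Longrightarrow> q 0 z = snd z"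
    and diff: "\<And>n z. z \<in> U \<Longrightarrow> p n differentiable (at z)"
              "\<And>n z. z \<in> U \<Longrightarrow> q n differentiable (at z)"
    and scheme_p: "\<And>n z j. z \<in> U \<Longrightarrow>
        (p (Suc n) z $ j - p n z $ j) / dt
        + (D2 \<alpha> a b N ix *v half_step q n z) $ j
        - lam * ((half_step p n z $ j)\<^sup>2 + (half_step q n z $ j)\<^sup>2) powr \<sigma> * half_step q n z $ j
        - half_step q n z $ j * noise_increment W dt n (grid_point a b N (ix j)) \<omega> = 0"
    and scheme_q: "\<And>n z j. z \<in> U \<Longrightarrow>
        (q (Suc n) z $ j - q n z $ j) / dt
        - (D2 \<alpha> a b N ix *v half_step p n z) $ j
        + lam * ((half_step p n z $ j)\<^sup>2 + (half_step q n z $ j)\<^sup>2) powr \<sigma> * half_step p n z $ j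
        + half_step p n z $ j * noise_increment W dt n (grid_point a b N (ix j)) \<omega> = 0"
  shows "\<forall>n. \<forall>z\<in>U. \<forall>v w.
    (\<Sum>j\<in>UNIV. (ext_d (\<lambda>y. p (Suc n) y $ j) \<and>\<^sub>d ext_d (\<lambda>y. q (Suc n) y $ j)) z v w)
    = (\<Sum>j\<in>UNIV. (ext_d (\<lambda>y. p n y $ j) \<and>\<^sub>d ext_d (\<lambda>y. q n y $ j)) z v w)"
proof (intro allI ballI)
  fix n z v w
  assume z: "z \<in> U"
  let ?D = "D2 \<alpha> a b N ix"
    and ?c = "\<lambda>j. noise_increment W dt n (grid_point a b N (ix j)) \<omega>"
    and ?z = "\<lambda>m y. (p m y, q m y)"
  define p' q' where "p' m = frechet_derivative (p m) (at z)"
    and "q' m = frechet_derivative (q m) (at z)" for m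
  have p': "(p m has_derivative p' m) (at z)" and q': "(q m has_derivative q' m) (at z)" for m
    using diff[OF z] by (simp_all add: p'_def q'_def frechet_derivative_works)
  have step: "?z (Suc n) y - ?z n y =
      symplectic_J (scheme_force dt ?D \<sigma> lam ?c ((1/2) *\<^sub>R (?z n y + ?z (Suc n) y)))"
    if "y \<in> U" for y
    using scheme_p[OF that, of n] scheme_q[OF that, of n] \<open>dt > 0\<close>
    by (intro midpoint_scheme_eq) (simp_all add: half_step_def)
  have "symplectic_form (p' (Suc n) v, q' (Suc n) v) (p' (Suc n) w, q' (Suc n) w) =
      symplectic_form (p' n v, q' n v) (p' n w, q' n w)"
    by (rule midpoint_step_symplectic[OF has_derivative_Pair[OF p' q'] has_derivative_Pair[OF p' q']
          has_derivative_scheme_force[OF \<open>\<sigma> > 0\<close>] scheme_hessian_symmetric[OF D2_symmetric]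
          \<open>open U\<close> z step])
  then show "(\<Sum>j\<in>UNIV. (ext_d (\<lambda>y. p (Suc n) y $ j) \<and>\<^sub>d ext_d (\<lambda>y. q (Suc n) y $ j)) z v w)
    = (\<Sum>j\<in>UNIV. (ext_d (\<lambda>y. p n y $ j) \<and>\<^sub>d ext_d (\<lambda>y. q n y $ j)) z v w)"
    by (simp only: sum_wedge_eq_symplectic_form[OF p' q'])
qed

end
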